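(* For all ordinary $\lambda$-terms $t,u$: if $t\sqsubseteq^{\mathrm{int\cdot imp}} u$ then $t\sqsubseteq_{\mathcal{B}\eta\mathrm{red}} u$.
   Context: Checkers terms: $t ::= x \mid \lambda_c x.t \mid t\cdot^{c} u$, $c\in\{\circ,\bullet\}$. A redex $(\lambda_c x.t)\cdot^{d}u \to t\{x:=u\}$ is silent if $c=d$, an interaction step if $c\neq d$; head reduction is closure under head contexts $\lambda_{c_1}x_1\ldots\lambda_{c_n}x_n.([\cdot]\cdot^{d_1}t_1\cdots\cdot^{d_k}t_k)$; $t\Downarrow^k$ means $t$ head-normalizes with exactly $k$ interaction steps in its head reduction sequence. $t^\bullet$ paints the $\lambda$-term $t$ entirely black. Interaction improvement: $t\sqsubseteq^{\mathrm{int\cdot imp}}u$ iff for every checkers (arbitrarily colored one-hole) context $C$ and every $k$, $C[t^\bullet]\Downarrow^k$ implies $C[u^\bullet]\Downarrow^{k'}$ for some $k'\le k$. $\sqsubseteq_{\mathcal{B}\eta\mathrm{red}}$ (Böhm tree preorder up to $\eta$-reductions) is the largest relation such that $t\sqsubseteq_{\mathcal{B}\eta\mathrm{red}}u$ implies either $t$ has no head normal form, or $t$ has head normal form $\lambda x_1\dots x_{n+p}.y\,t_1\cdots t_{k+p}$ and $u$ has head normal form $\lambda x_1\dots x_n.y\,u_1\cdots u_k$ with $p\ge0$, $y$ equally bound or free in both, $t_i\sqsubseteq_{\mathcal{B}\eta\mathrm{red}}u_i$ ($i\le k$), $t_i\sqsubseteq_{\mathcal{B}\eta\mathrm{red}}x_i$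 ($k<i\le k+p$), and $x_{k+1},\dots,x_{k+p}$ not free in $y\,u_1\cdots u_k$.
   Formalization: In the Böhm preorder the extra binders are taken to be x_{n+1},…,x_{n+p}: the clauses read t_{k+j} ⊑ x_{n+j} for 1≤j≤p, and x_{n+1},…,x_{n+p} not free in y u_1⋯u_k; the printed indices x_{k+1},…,x_{k+p} are meaningful only when n=k. *)

theory Defs
  imports Main
begin

text \<open>
  Terms in de Bruijn notation whose abstractions and applications carry a tag of type \<open>'c\<close>.
  Checkers terms are tagged with colors; ordinary \<open>\<lambda>\<close>-terms are the instance with a trivial tag.
\<close>

datatype 'c trm = Var nat | Lam 'c "'c trm" | App 'c "'c trm" "'c trm"

datatype color = White | Black

type_synonym checkers = "color trm"
type_synonym lterm = "unit trm"

text \<open>Weakening: \<open>lift p k t\<close> adds \<open>p\<close> to every variable of \<open>t\<close> that is free at depth \<open>k\<close>.\<close>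

primrec lift :: "nat \<Rightarrow> nat \<Rightarrow> 'c trm \<Rightarrow> 'c trm" where
  "lift p k (Var i) = (if i < k then Var i else Var (i + p))"
| "lift p k (Lam c t) = Lam c (lift p (Suc k) t)"
| "lift p k (App c t u) = App c (lift p k t) (lift p k u)"

text \<open>The substituted index is removed, so \<open>subst t u 0\<close> is the contractum of a redex.\<close>

primrec subst :: "'c trm \<Rightarrow> 'c trm \<Rightarrow> nat \<Rightarrow> 'c trm" where
  "subst (Var i) s k = (if k < i then Var (i - 1) else if i = k then s else Var i)"
| "subst (Lam c t) s k = Lam c (subst t (lift 1 0 s) (Suc k))"
| "subst (App c t u) s k = App c (subst t s k) (subst u s k)"

definition lams :: "'c list \<Rightarrow> 'c trm \<Rightarrow> 'c trm" where
  "lams cs t = foldr Lam cs t"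

definition apps :: "'c trm \<Rightarrow> ('c \<times> 'c trm) list \<Rightarrow> 'c trm" where
  "apps t us = foldl (\<lambda>s (d, u). App d s u) t us"

text \<open>
  The Boolean label tells interaction steps (\<open>True\<close>) from silent ones (\<open>False\<close>).
  On ordinary terms every step is labelled \<open>False\<close>, and \<open>head_red\<close> is the usual head reduction.
\<close>

inductive head_step :: "bool \<Rightarrow> 'c trm \<Rightarrow> 'c trm \<Rightarrow> bool" where
  "head_step (c \<noteq> d)
     (lams cs (apps (App d (Lam c t) u) us))
     (lams cs (apps (subst t u 0) us))"

definition head_red :: "'c trm \<Rightarrow> 'c trm \<Rightarrow> bool" where
  "head_red t u \<longleftrightarrow> (\<exists>b. head_step b t u)"

definition head_normal :: "'c trm \<Rightarrow> bool" where
  "head_normal t \<longleftrightarrow> (\<nexists>u. head_red t u)"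

inductive head_reds :: "nat \<Rightarrow> 'c trm \<Rightarrow> 'c trm \<Rightarrow> bool" where
  refl: "head_reds 0 t t"
| step: "head_step b t t' \<Longrightarrow> head_reds k t' u \<Longrightarrow> head_reds (of_bool b + k) t u"

definition converges :: "'c trm \<Rightarrow> nat \<Rightarrow> bool" (infix "\<Down>" 50) where
  "t \<Down> k \<longleftrightarrow> (\<exists>u. head_reds k t u \<and> head_normal u)"

datatype 'c ctx =
    Hole
  | CLam 'c "'c ctx"
  | CAppL 'c "'c ctx" "'c trm"
  | CAppR 'c "'c trm" "'c ctx"

text \<open>
  Plugging does not lift: the abstractions above the hole capture the free variables
  of the plugged term.
\<close>

primrec plug :: "'c ctx \<Rightarrow> 'c trm \<Rightarrow> 'c trm" where
  "plug Hole t = t"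
| "plug (CLam c C) t = Lam c (plug C t)"
| "plug (CAppL c C u) t = App c (plug C t) u"
| "plug (CAppR c u C) t = App c u (plug C t)"

definition paint_black :: "lterm \<Rightarrow> checkers" where
  "paint_black t = map_trm (\<lambda>_. Black) t"

definition int_imp :: "lterm \<Rightarrow> lterm \<Rightarrow> bool" where
  "int_imp t u \<longleftrightarrow>
     (\<forall>(C :: color ctx) k. plug C (paint_black t) \<Down> k \<longrightarrow>
        (\<exists>k'\<le>k. plug C (paint_black u) \<Down> k'))"

definition has_hnf :: "lterm \<Rightarrow> bool" where
  "has_hnf t \<longleftrightarrow> (\<exists>h. head_red\<^sup>*\<^sup>* t h \<and> head_normal h)"

text \<open>The ordinary term \<open>\<lambda>x\<^sub>1\<dots>x\<^sub>n. y t\<^sub>1 \<dots> t\<^sub>k\<close>; the binder \<open>x\<^sub>i\<close> has index \<open>n - i\<close> in its body.\<close>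

definition hnf :: "nat \<Rightarrow> nat \<Rightarrow> lterm list \<Rightarrow> lterm" where
  "hnf n y ts = (Lam () ^^ n) (foldl (App ()) (Var y) ts)"

text \<open>
  The head normal form of \<open>u\<close> has \<open>p\<close> fewer binders than that of \<open>t\<close>, so its body is compared
  with that of \<open>t\<close> after weakening by \<open>p\<close>. As a weakened term, it does not contain the additional
  binders \<open>x\<^sub>n\<^sub>+\<^sub>1, \<dots>, x\<^sub>n\<^sub>+\<^sub>p\<close> of \<open>t\<close>, whose indices are \<open>p - 1, \<dots>, 0\<close>: this is the
  condition that they are not free in \<open>y u\<^sub>1 \<dots> u\<^sub>k\<close>.
\<close>

coinductive bohm_eta_red :: "lterm \<Rightarrow> lterm \<Rightarrow> bool" where
  no_hnf: "\<not> has_hnf t \<Longrightarrow> bohm_eta_red t u"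
| hnf: "\<lbrakk>head_red\<^sup>*\<^sup>* t (hnf (n + p) (y + p) ts);
         head_red\<^sup>*\<^sup>* u (hnf n y us);
         length us = k; length ts = k + p;
         \<forall>i<k. bohm_eta_red (ts ! i) (lift p 0 (us ! i));
         \<forall>j<p. bohm_eta_red (ts ! (k + j)) (Var (p - 1 - j))\<rbrakk>
        \<Longrightarrow> bohm_eta_red t u"

end

theory Submission
  imports Defs
begin

text \<open>
  A coinductive form of Boehm-out. Every variable is replaced by a white tupler
  \<open>\<lambda>z\<^sub>1 \<dots> z\<^sub>q z. z z\<^sub>1 \<dots> z\<^sub>q\<close>, with \<open>q\<close> chosen freely per variable above some
  bound, and terms are compared under applicative contexts only. The resulting relation is a
  post-fixed point of the definition of the Boehm preorder.

  Feeding enough arguments to a head normal form makes some argument of the context the head, and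
  its position determines the head variable and the difference between the numbers of arguments
  and binders. If the fed arguments are applied in white, every binder of the (black) head normal
  form and every argument of its head variable costs one interaction, so the improvement forces
  \<open>t\<close> to be the more \<open>\<eta>\<close>-expanded side. If they are applied in black, only the tupler costs
  anything and the cost is the same on both sides, so a selector extracts the \<open>i\<close>-th arguments,
  under the same kind of substitution, with no loss in the comparison.
\<close>

section \<open>Parallel substitution\<close>

definition up :: "(nat \<Rightarrow> 'c trm) \<Rightarrow> nat \<Rightarrow> 'c trm" where
  "up \<sigma> = case_nat (Var 0) (\<lambda>i. lift 1 0 (\<sigma> i))"

primrec psubst :: "(nat \<Rightarrow> 'c trm) \<Rightarrow> 'c trm \<Rightarrow> 'c trm" where
  "psubst \<sigma> (Var i) = \<sigma> i"
| "psubst \<sigma> (Lam c t) = Lam c (psubst (up \<sigma>) t)"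
| "psubst \<sigma> (App c t u) = App c (psubst \<sigma> t) (psubst \<sigma> u)"

lemma up_simps [simp]: "up \<sigma> 0 = Var 0" "up \<sigma> (Suc i) = lift 1 0 (\<sigma> i)"
  by (simp_all add: up_def)

lemma up_Var [simp]: "up Var = Var"
  by (rule ext) (simp add: up_def split: nat.split)

lemma psubst_Var [simp]: "psubst Var t = t"
  by (induction t) simp_all

lemma psubst_lift_gen:
  "psubst \<sigma> (lift p k t) = psubst (\<lambda>i. if i < k then \<sigma> i else \<sigma> (i + p)) t"
proof (induction t arbitrary: \<sigma> k)
  case (Lam c t)
  have "(\<lambda>i. if i < Suc k then up \<sigma> i else up \<sigma> (i + p))
      = up (\<lambda>i. if i < k then \<sigma> i else \<sigma> (i + p))"
    by (rule ext) (simp add: up_def split: nat.split)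
  then show ?case
    by (simp add: Lam)
qed simp_all

lemma psubst_lift: "psubst \<sigma> (lift p 0 t) = psubst (\<lambda>i. \<sigma> (i + p)) t"
  by (simp add: psubst_lift_gen)

lemma lift_lift: "j \<le> k \<Longrightarrow> lift p (Suc k) (lift 1 j t) = lift 1 j (lift p k t)"
  by (induction t arbitrary: j k) auto

lemma lift_psubst: "lift p k (psubst \<sigma> t) = psubst (\<lambda>i. lift p k (\<sigma> i)) t"
proof (induction t arbitrary: \<sigma> k)
  case (Lam c t)
  have "(\<lambda>i. lift p (Suc k) (up \<sigma> i)) = up (\<lambda>i. lift p k (\<sigma> i))"
    by (rule ext) (simp add: up_def lift_lift[of 0, simplified] split: nat.split)
  then show ?case
    by (simp add: Lam)
qed simp_all

lemma psubst_psubst: "psubst \<sigma> (psubst \<tau> t) = psubst (\<lambda>i. psubst \<sigma> (\<tau> i)) t"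
proof (induction t arbitrary: \<sigma> \<tau>)
  case (Lam c t)
  have "(\<lambda>i. psubst (up \<sigma>) (up \<tau> i)) = up (\<lambda>i. psubst \<sigma> (\<tau> i))"
    by (rule ext) (simp add: up_def psubst_lift lift_psubst split: nat.split)
  then show ?case
    by (simp add: Lam)
qed simp_all

text \<open>Writing the values as \<open>subst (Var i) u k\<close> makes the induction close: under
  a binder this function turns into its own \<open>up\<close>.\<close>

lemma subst_eq_psubst_gen: "subst t u k = psubst (\<lambda>i. subst (Var i) u k) t"
proof (induction t arbitrary: u k)
  case (Lam c t)
  have "(\<lambda>i. subst (Var i) (lift 1 0 u) (Suc k)) = up (\<lambda>i. subst (Var i) u k)"
    by (rule ext) (auto simp: up_def split: nat.split)
  then show ?case
    using Lam[of "lift 1 0 u" "Suc k"] by simp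
qed simp_all

lemma subst_eq_psubst: "subst t u 0 = psubst (case_nat u Var) t"
proof -
  have "(\<lambda>i. subst (Var i) u 0) = case_nat u Var"
    by (rule ext) (simp split: nat.split)
  then show ?thesis
    using subst_eq_psubst_gen[of t u 0] by simp
qed

lemma subst_psubst_up: "subst (psubst (up \<sigma>) t) v 0 = psubst (case_nat v \<sigma>) t"
proof -
  have "(\<lambda>i. psubst (case_nat v Var) (up \<sigma> i)) = case_nat v \<sigma>"
    by (rule ext) (simp add: up_def psubst_lift split: nat.split)
  then show ?thesis
    by (simp add: subst_eq_psubst psubst_psubst)
qed

lemma psubst_subst: "psubst \<sigma> (subst t u 0) = subst (psubst (up \<sigma>) t) (psubst \<sigma> u) 0"
proof -
  have "(\<lambda>i. psubst \<sigma> (case_nat u Var i)) = case_nat (psubst \<sigma> u) \<sigma>"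
    by (rule ext) (simp split: nat.split)
  then show ?thesis
    by (simp add: subst_psubst_up) (simp add: subst_eq_psubst psubst_psubst)
qed

text \<open>Finiteness of the set of free variables. A context can bind only finitely many of them,
  whereas \<open>tsubst\<close> replaces all.\<close>

lemma psubst_finite_support:
  "\<exists>N. \<forall>\<sigma> \<tau>. (\<forall>i<N. \<sigma> i = \<tau> i) \<longrightarrow> psubst \<sigma> t = psubst \<tau> t"
proof (induction t)
  case (Var i)
  show ?case by (rule exI[of _ "Suc i"]) simp
next
  case (Lam c t)
  then obtain N where N: "\<And>\<sigma> \<tau>. (\<forall>i<N. \<sigma> i = \<tau> i) \<Longrightarrow> psubst \<sigma> t = psubst \<tau> t"
    by blast
  have "psubst (up \<sigma>) t = psubst (up \<tau>) t" if "\<forall>i<N. \<sigma> i = \<tau> i" for \<sigma> \<tau>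
    by (rule N) (use that in \<open>auto simp: up_def split: nat.split\<close>)
  then show ?case by auto
next
  case (App c t u)
  then obtain N M where
      "\<And>\<sigma> \<tau>. (\<forall>i<N. \<sigma> i = \<tau> i) \<Longrightarrow> psubst \<sigma> t = psubst \<tau> t"
      "\<And>\<sigma> \<tau>. (\<forall>i<M. \<sigma> i = \<tau> i) \<Longrightarrow> psubst \<sigma> u = psubst \<tau> u"
    by blast
  then show ?case
    by (intro exI[of _ "max N M"]) (metis less_max_iff_disj psubst.simps(3))
qed

lemma map_trm_lift: "map_trm f (lift p k t) = lift p k (map_trm f t)"
  by (induction t arbitrary: k) auto

lemma map_trm_subst: "map_trm f (subst t u k) = subst (map_trm f t) (map_trm f u) k"
  by (induction t arbitrary: u k) (auto simp: map_trm_lift)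

section \<open>Structural head reduction\<close>

fun is_Lam :: "'c trm \<Rightarrow> bool" where
  "is_Lam (Lam c t) = True"
| "is_Lam t = False"

text \<open>The condition in \<open>appL\<close> reflects that the abstractions of a head context
  lie outside its applications; it makes the reduction deterministic.\<close>

inductive hs :: "bool \<Rightarrow> 'c trm \<Rightarrow> 'c trm \<Rightarrow> bool" where
  beta: "b = (c \<noteq> d) \<Longrightarrow> hs b (App d (Lam c t) u) (subst t u 0)"
| appL: "hs b t t' \<Longrightarrow> \<not> is_Lam t \<Longrightarrow> hs b (App d t u) (App d t' u)"
| lam: "hs b t t' \<Longrightarrow> hs b (Lam c t) (Lam c t')"

inductive_cases hs_VarE [elim!]: "hs b (Var i) t"
inductive_cases hs_LamE: "hs b (Lam c t) s"
inductive_cases hs_AppE: "hs b (App c t u) s"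

lemma apps_simps [simp]:
  "apps t [] = t"
  "apps t ((d, u) # us) = apps (App d t u) us"
  "apps t (us @ vs) = apps (apps t us) vs"
  by (simp_all add: apps_def)

lemma hs_apps: "hs b t t' \<Longrightarrow> \<not> is_Lam t \<Longrightarrow> hs b (apps t us) (apps t' us)"
proof (induction us arbitrary: t t')
  case (Cons v us)
  then show ?case by (cases v) (simp add: appL)
qed simp

lemma head_step_iff_hs: "head_step b t t' \<longleftrightarrow> hs b t t'"
proof
  show "hs b t t'" if "head_step b t t'"
    using that
  proof cases
    case (1 c d cs s u us)
    have "hs b (apps (App d (Lam c s) u) us) (apps (subst s u 0) us)"
      by (rule hs_apps) (simp_all add: beta 1)
    then show ?thesis
      unfolding 1 by (induction cs) (simp_all add: lams_def lam)
  qed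
  show "head_step b t t'" if "hs b t t'"
    using that
  proof induction
    case (beta b c d t u)
    show ?case
      using head_step.intros[of c d "[]" t u "[]"] by (simp add: lams_def beta)
  next
    case (appL b t t' d u)
    from appL.IH show ?case
    proof cases
      case (1 c d' cs s v us)
      have [simp]: "cs = []"
        using appL.hyps 1 by (cases cs) (auto simp: lams_def)
      show ?thesis
        using head_step.intros[of c d' "[]" s v "us @ [(d, u)]"] 1 by (simp add: lams_def)
    qed
  next
    case (lam b t t' c)
    from lam.IH show ?case
    proof cases
      case (1 c' d' cs s v us)
      then show ?thesis
        using head_step.intros[of c' d' "c # cs" s v us] by (simp add: lams_def)
    qed
  qed
qed

lemma hs_deterministic: "hs b t t1 \<Longrightarrow> hs b' t t2 \<Longrightarrow> b' = b \<and> t2 = t1"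
proof (induction arbitrary: b' t2 rule: hs.induct)
  case (beta b c d t u)
  from beta.prems show ?case
    by (rule hs_AppE) (use beta.hyps in simp_all)
next
  case (appL b t t' d u)
  from appL.prems show ?case
  proof (rule hs_AppE)
    fix t'' assume "t2 = App d t'' u" "hs b' t t''"
    with appL.IH show ?thesis by blast
  qed (use appL.hyps in simp)
next
  case (lam b t t' c)
  from lam.prems show ?case
    by (rule hs_LamE) (use lam.IH in blast)
qed

lemma head_normal_iff: "head_normal t \<longleftrightarrow> (\<nexists>b u. hs b t u)"
  by (auto simp: head_normal_def head_red_def head_step_iff_hs)

lemma head_normal_apps_Var: "head_normal (apps (Var i) us)"
proof (induction us rule: rev_induct)
  case Nil
  show ?case by (auto simp: head_normal_iff)
next
  case (snoc v us)
  obtain d u where v: "v = (d, u)" by force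
  have "\<not> is_Lam (apps (Var i) us)"
    by (cases us rule: rev_cases) (auto simp: apps_def split: prod.splits)
  then have "\<not> hs b (App d (apps (Var i) us) u) s" for b s
    using snoc by (auto simp: head_normal_iff elim: hs_AppE)
  then show ?case by (simp add: v head_normal_iff)
qed

text \<open>Substitution can create an abstraction at the root only from a variable, and a variable
  takes no step.\<close>

lemma is_Lam_psubst: "hs b t t' \<Longrightarrow> \<not> is_Lam t \<Longrightarrow> \<not> is_Lam (psubst \<sigma> t)"
  by (cases t) auto

lemma hs_psubst: "hs b t t' \<Longrightarrow> hs b (psubst \<sigma> t) (psubst \<sigma> t')"
proof (induction arbitrary: \<sigma> rule: hs.induct)
  case (beta b c d t u)
  then show ?case by (simp add: psubst_subst hs.beta)
next
  case (appL b t t' d u)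
  then show ?case by (simp add: hs.appL is_Lam_psubst)
next
  case (lam b t t' c)
  then show ?case by (simp add: hs.lam)
qed

text \<open>A painted redex has black on both sides, so it fires silently.\<close>

lemma hs_paint_black: "hs b t t' \<Longrightarrow> hs False (paint_black t) (paint_black t')"
  unfolding paint_black_def
proof (induction rule: hs.induct)
  case (beta b c d t u)
  show ?case by (simp add: map_trm_subst hs.beta)
next
  case (appL b t t' d u)
  then have "\<not> is_Lam (map_trm (\<lambda>_. Black) t)"
    by (cases t) auto
  with appL show ?case by (simp add: hs.appL)
next
  case (lam b t t' c)
  then show ?case by (simp add: hs.lam)
qed

section \<open>Convergence\<close>

text \<open>The first index counts all head steps, the second one only interactions.\<close>

inductive conv :: "nat \<Rightarrow> nat \<Rightarrow> 'c trm \<Rightarrow> bool" where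
  normal: "head_normal t \<Longrightarrow> conv 0 0 t"
| step: "hs b t t' \<Longrightarrow> conv l k t' \<Longrightarrow> conv (Suc l) (k + of_bool b) t"

lemma converges_iff_conv: "t \<Down> k \<longleftrightarrow> (\<exists>l. conv l k t)"
proof
  assume "t \<Down> k"
  then obtain u where "head_reds k t u" "head_normal u"
    by (auto simp: converges_def)
  then show "\<exists>l. conv l k t"
  proof (induction rule: head_reds.induct)
    case (step b t t' k u)
    then show ?case
      by (metis head_step_iff_hs conv.step add.commute)
  qed (use conv.normal in blast)
next
  assume "\<exists>l. conv l k t"
  then obtain l where "conv l k t" ..
  then show "t \<Down> k"
  proof (induction rule: conv.induct)
    case (normal t)
    then show ?case
      unfolding converges_def using head_reds.refl by blast
  next
    case (step b t t' l k)
    then show ?case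
      unfolding converges_def
      by (metis head_step_iff_hs head_reds.step add.commute)
  qed
qed

lemma conv_hs_iff:
  assumes "hs b t t'"
  shows "conv l k t \<longleftrightarrow> (\<exists>l' k'. l = Suc l' \<and> k = k' + of_bool b \<and> conv l' k' t')"
proof
  assume "conv l k t"
  then show "\<exists>l' k'. l = Suc l' \<and> k = k' + of_bool b \<and> conv l' k' t'"
  proof cases
    case normal
    then show ?thesis using assms by (auto simp: head_normal_iff)
  next
    case (step b' t'' l' k')
    then show ?thesis using hs_deterministic[OF assms, of b' t''] by blast
  qed
next
  assume "\<exists>l' k'. l = Suc l' \<and> k = k' + of_bool b \<and> conv l' k' t'"
  then show "conv l k t" using assms conv.step by blast
qed

text \<open>
  If the stepping term is an abstraction, its application to \<open>us\<close> fires another redex first;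
  the two steps commute without changing the total cost.
\<close>

lemma conv_apps_hs_iff:
  assumes "hs b t t'"
  shows "conv l k (apps t us)
     \<longleftrightarrow> (\<exists>l' k'. l = Suc l' \<and> k = k' + of_bool b \<and> conv l' k' (apps t' us))"
  using assms
proof (induction us arbitrary: t t' l k)
  case Nil
  then show ?case by (simp add: conv_hs_iff)
next
  case (Cons w us)
  obtain d v where w: "w = (d, v)" by force
  show ?case
  proof (cases "is_Lam t")
    case False
    then show ?thesis
      using conv_hs_iff[OF hs_apps[OF Cons.prems]] by blast
  next
    case True
    then obtain c s where t: "t = Lam c s" by (cases t) auto
    with Cons.prems obtain s' where t': "t' = Lam c s'" and s: "hs b s s'"
      by (auto elim: hs_LamE)
    have 1: "hs (c \<noteq> d) (apps (App d (Lam c r) v) us) (apps (subst r v 0) us)" for r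
      by (rule hs_apps) (simp_all add: beta)
    have "hs b (subst s v 0) (subst s' v 0)"
      using s by (simp add: subst_eq_psubst hs_psubst)
    note 2 = Cons.IH[OF this]
    show ?thesis
      by (auto simp: w t t' conv_hs_iff[OF 1] 2)
  qed
qed

section \<open>Exact comparison of interaction costs\<close>

definition ahead :: "nat \<Rightarrow> 'c trm \<Rightarrow> 'c trm \<Rightarrow> bool" where
  "ahead c t u \<longleftrightarrow> (\<forall>k. t \<Down> k \<longleftrightarrow> (\<exists>k'. k = k' + c \<and> u \<Down> k'))"

lemma ahead_refl: "ahead 0 t t"
  by (simp add: ahead_def)

lemma ahead_trans: "ahead a t u \<Longrightarrow> ahead b u v \<Longrightarrow> ahead (a + b) t v"
  unfolding ahead_def by auto

text \<open>Once arguments are appended, a step below an abstraction is no longer the next one to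
  fire. Hence \<open>ahead\<close> compares the costs of convergence instead of asking for a
  reduction to the second term.\<close>

lemma ahead_apps_hs: "hs b t t' \<Longrightarrow> ahead (of_bool b) (apps t us) (apps t' us)"
  unfolding ahead_def converges_iff_conv by (subst conv_apps_hs_iff) blast+

text \<open>Both sides shed the same cost \<open>c\<close>, which cancels in the inequality.\<close>

lemma ahead_transfer:
  assumes "ahead c t t'" "ahead c u u'"
    and "\<And>k. t \<Down> k \<Longrightarrow> \<exists>k'\<le>k. u \<Down> k'"
    and "t' \<Down> k"
  shows "\<exists>k'\<le>k. u' \<Down> k'"
proof -
  have "t \<Down> (k + c)" using assms(1,4) by (auto simp: ahead_def)
  then obtain k' where "k' \<le> k + c" "u \<Down> k'" using assms(3) by blast
  then show ?thesis using assms(2) by (auto simp: ahead_def)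
qed

lemma apps_Var_converges: "apps (Var i) us \<Down> k \<longleftrightarrow> k = 0"
  using head_normal_apps_Var[of i us]
  by (auto simp: converges_iff_conv head_normal_iff elim: conv.cases
      intro!: exI[of _ 0] conv.normal)

lemma ahead_apps_Var: "ahead c t (apps (Var i) us) \<Longrightarrow> t \<Down> c"
  by (simp add: ahead_def apps_Var_converges)

definition Omega :: checkers where
  "Omega = (let w = Lam White (App White (Var 0) (Var 0)) in App White w w)"

lemma hs_Omega: "hs False Omega Omega"
  using hs.beta[of False White White "App White (Var 0) (Var 0)" "Lam White (App White (Var 0) (Var 0))"]
  by (simp add: Omega_def Let_def)

text \<open>The loop is silent, so the interaction count never decreases; the induction is on the
  total number of steps.\<close>

lemma Omega_diverges: "\<not> apps Omega us \<Down> k"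
proof -
  have "\<not> conv l k (apps Omega us)" for l k
    by (induction l arbitrary: k) (subst conv_apps_hs_iff[OF hs_Omega], simp)+
  then show ?thesis by (simp add: converges_iff_conv)
qed

text \<open>Every head step of \<open>t\<close> shortens the converging reduction by one step, so
  the head reduction of \<open>t\<close> must stop.\<close>

lemma converges_imp_has_hnf:
  assumes "apps (psubst \<sigma> (paint_black t)) us \<Down> k"
  shows "has_hnf t"
proof -
  obtain l where "conv l k (apps (psubst \<sigma> (paint_black t)) us)"
    using assms by (auto simp: converges_iff_conv)
  then show ?thesis
  proof (induction l arbitrary: k t rule: less_induct)
    case (less l)
    show ?case
    proof (cases "head_normal t")
      case True
      then show ?thesis by (auto simp: has_hnf_def)
    next
      case False
      then obtain b t' where t': "hs b t t'" by (auto simp: head_normal_iff)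
      with less.prems obtain l' k' where
          "l = Suc l'" "conv l' k' (apps (psubst \<sigma> (paint_black t')) us)"
        by (auto simp: conv_apps_hs_iff[OF hs_psubst[OF hs_paint_black[OF t']]])
      then have "has_hnf t'" using less.IH by blast
      moreover have "head_red t t'"
        using t' by (auto simp: head_red_def head_step_iff_hs)
      ultimately show ?thesis
        unfolding has_hnf_def by (meson converse_rtranclp_into_rtranclp)
    qed
  qed
qed

lemma ahead_head_red:
  assumes "head_red\<^sup>*\<^sup>* t t'"
  shows "ahead 0 (apps (psubst \<sigma> (paint_black t)) us) (apps (psubst \<sigma> (paint_black t')) us)"
  using assms
proof (induction rule: rtranclp_induct)
  case base
  show ?case by (rule ahead_refl)
next
  case (step v w)
  then obtain b where "hs b v w" by (auto simp: head_red_def head_step_iff_hs)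
  from ahead_trans[OF step.IH ahead_apps_hs[OF hs_psubst[OF hs_paint_black[OF this]]]]
  show ?case by simp
qed

lemma hnf_or_hs: "(\<exists>n y ts. t = hnf n y ts) \<or> (\<exists>b t'. hs b t t')"
proof (induction t)
  case (Var i)
  have "Var i = hnf 0 i []" by (simp add: hnf_def)
  then show ?case by blast
next
  case (Lam c t)
  have "Lam c (hnf n y ts) = hnf (Suc n) y ts" for n y ts by (simp add: hnf_def)
  with Lam show ?case by (metis hs.lam)
next
  case (App c t u)
  show ?case
  proof (cases "is_Lam t")
    case True
    then obtain d s where "t = Lam d s" by (cases t) auto
    then show ?thesis using hs.beta[OF HOL.refl, of d c s u] by blast
  next
    case False
    from App.IH(1) show ?thesis
    proof
      assume "\<exists>n y ts. t = hnf n y ts"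
      then obtain n y ts where t: "t = hnf n y ts" by blast
      with False have "n = 0" by (cases n) (auto simp: hnf_def)
      with t have "App c t u = hnf 0 y (ts @ [u])" by (simp add: hnf_def)
      then show ?thesis by blast
    next
      assume "\<exists>b t'. hs b t t'"
      then obtain b t' where "hs b t t'" by blast
      then have "hs b (App c t u) (App c t' u)" using False by (rule hs.appL)
      then show ?thesis by blast
    qed
  qed
qed

lemma has_hnfE:
  assumes "has_hnf t"
  obtains n y ts where "head_red\<^sup>*\<^sup>* t (hnf n y ts)"
  using assms hnf_or_hs by (metis has_hnf_def head_normal_iff)

section \<open>Tuplers and selectors\<close>

lemma ahead_Lams:
  assumes "length vs = m"
  shows "ahead (length (filter (\<lambda>v. fst v \<noteq> c) vs))
           (apps (psubst \<sigma> ((Lam c ^^ m) s)) (vs @ us))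
           (apps (psubst (\<lambda>i. if i < m then snd (vs ! (m - 1 - i)) else \<sigma> (i - m)) s) us)"
  using assms
proof (induction m arbitrary: \<sigma> vs)
  case 0
  then show ?case by (simp add: ahead_refl)
next
  case (Suc m)
  then obtain d v ws where vs: "vs = (d, v) # ws" and ws: "length ws = m"
    by (cases vs) auto
  have "hs (c \<noteq> d) (App d (psubst \<sigma> ((Lam c ^^ Suc m) s)) v) (psubst (case_nat v \<sigma>) ((Lam c ^^ m) s))"
    using hs.beta[of "c \<noteq> d" c d "psubst (up \<sigma>) ((Lam c ^^ m) s)" v]
    by (simp add: subst_psubst_up)
  note 1 = ahead_trans[OF ahead_apps_hs[OF this, of "ws @ us"] Suc.IH[OF ws]]
  \<comment> \<open>The outermost binder takes the first argument \<open>v\<close> and has index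
    \<open>m\<close> in the body; the later arguments fill the smaller indices in reverse
    order.\<close>
  have "(\<lambda>i. if i < m then snd (ws ! (m - 1 - i)) else case_nat v \<sigma> (i - m))
      = (\<lambda>i. if i < Suc m then snd (vs ! (Suc m - 1 - i)) else \<sigma> (i - Suc m))"
  proof
    fix i
    consider "i < m" | "i = m" | "m < i" by linarith
    then show "(if i < m then snd (ws ! (m - 1 - i)) else case_nat v \<sigma> (i - m))
      = (if i < Suc m then snd (vs ! (Suc m - 1 - i)) else \<sigma> (i - Suc m))"
    proof cases
      case 1
      then have "m - i = Suc (m - 1 - i)" by simp
      with 1 show ?thesis by (simp add: vs)
    next
      case 3
      then have "i - m = Suc (i - Suc m)" by simp
      with 3 show ?thesis by simp
    qed (simp add: vs)
  qed
  with 1 show ?case by (cases "c = d") (simp_all add: vs)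
qed

definition tupler :: "nat \<Rightarrow> checkers" where
  "tupler q = (Lam White ^^ Suc q) (apps (Var 0) (map (\<lambda>i. (White, Var (q - i))) [0..<q]))"

lemma psubst_apps: "psubst \<sigma> (apps t us) = apps (psubst \<sigma> t) (map (map_prod id (psubst \<sigma>)) us)"
  by (induction us arbitrary: t) auto

text \<open>Whatever color the first \<open>q\<close> arguments had, they come back in white: colors
  are paid for here, and a white selector brought to the head then works for free.\<close>

lemma ahead_tupler:
  assumes "length vs = q"
  shows "ahead (length (filter (\<lambda>v. fst v \<noteq> White) (vs @ [(d, s)])))
           (apps (tupler q) (vs @ (d, s) # us)) (apps s (map (Pair White \<circ> snd) vs @ us))"
proof -
  let ?vs = "vs @ [(d, s)]"
  let ?\<sigma> = "\<lambda>i. if i < Suc q then snd (?vs ! (Suc q - 1 - i)) else Var (i - Suc q)"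
  have "map (map_prod id (psubst ?\<sigma>)) (map (\<lambda>i. (White, Var (q - i))) [0..<q])
      = map (Pair White \<circ> snd) vs"
    using assms by (intro nth_equalityI) (auto simp: nth_append)
  moreover have "?\<sigma> 0 = s"
    using assms by (simp add: nth_append)
  ultimately show ?thesis
    using ahead_Lams[of ?vs "Suc q" White Var "apps (Var 0) (map (\<lambda>i. (White, Var (q - i))) [0..<q])" us] assms
    by (simp add: tupler_def psubst_apps)
qed

definition selector :: "nat \<Rightarrow> nat \<Rightarrow> checkers" where
  "selector i q = (Lam White ^^ q) (Var (q - 1 - i))"

lemma ahead_selector:
  assumes "length vs = q" "i < q"
  shows "ahead 0 (apps (selector i q) (map (Pair White) vs @ us)) (apps (vs ! i) us)"
  using ahead_Lams[of "map (Pair White) vs" q White Var "Var (q - 1 - i)" us] assms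
  by (simp add: selector_def o_def)

lemma paint_black_hnf:
  "paint_black (hnf m y ts) = (Lam Black ^^ m) (apps (Var y) (map (\<lambda>s. (Black, paint_black s)) ts))"
proof -
  have "map_trm f (foldl (App ()) s ts)
      = apps (map_trm f s) (map (\<lambda>s. (f (), map_trm f s)) ts)" for f :: "unit \<Rightarrow> color" and s
    by (induction ts arbitrary: s) simp_all
  moreover have "map_trm f ((Lam () ^^ m) s) = (Lam (f ()) ^^ m) (map_trm f s)"
    for f :: "unit \<Rightarrow> color" and s
    by (induction m) simp_all
  ultimately show ?thesis by (simp add: paint_black_def hnf_def)
qed

section \<open>Feeding tuplers to head normal forms\<close>

abbreviation tsubst :: "(nat \<Rightarrow> nat) \<Rightarrow> checkers \<Rightarrow> checkers" where
  "tsubst q \<equiv> psubst (\<lambda>i. tupler (q i))"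

text \<open>The order is reversed so that, once \<open>M\<close> binders have absorbed the list, the
  variable of index \<open>i\<close> has become \<open>tupler (q i)\<close>.\<close>

definition feed :: "color \<Rightarrow> nat \<Rightarrow> (nat \<Rightarrow> nat) \<Rightarrow> (color \<times> checkers) list" where
  "feed d M q = map (\<lambda>j. (d, tupler (q (M - 1 - j)))) [0..<M]"

text \<open>A head normal form with \<open>m\<close> binders absorbs only a prefix. Indices in its
  body are \<open>M - m\<close> lower than under \<open>M\<close> binders, hence the shift of
  \<open>q\<close>.\<close>

lemma feed_split:
  assumes "m \<le> M"
  shows "feed d M q = feed d m (\<lambda>i. q (i + (M - m))) @ map (\<lambda>j. (d, tupler (q (M - 1 - j)))) [m..<M]"
proof -
  have "[0..<M] = [0..<m] @ [m..<M]"
    using upt_add_eq_append[of 0 m "M - m"] assms by simp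
  then show ?thesis using assms by (simp add: feed_def)
qed

text \<open>The outer substitution \<open>\<tau>\<close> is arbitrary because outer variables become
  tuplers in \<open>ahead_hnf\<close> but stay variables in the closing context of
  \<open>int_imp_imp_tupled_imp\<close>.\<close>

lemma ahead_feed:
  assumes "\<And>i. i < m \<Longrightarrow> \<sigma> i = tupler (q i)" "\<And>i. \<sigma> (i + m) = \<tau> i"
  shows "ahead (if d = c then 0 else m) (apps (psubst \<tau> ((Lam c ^^ m) s)) (feed d m q @ us))
           (apps (psubst \<sigma> s) us)"
proof -
  have "(\<lambda>i. if i < m then snd (feed d m q ! (m - 1 - i)) else \<tau> (i - m)) = \<sigma>"
    using assms by (auto simp: feed_def simp flip: assms(2))
  moreover have "length (filter (\<lambda>v. fst v \<noteq> c) (feed d m q)) = (if d = c then 0 else m)"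
    by (simp add: feed_def filter_map o_def)
  ultimately show ?thesis
    using ahead_Lams[of "feed d m q" m c \<tau> s us] by (simp add: feed_def)
qed

text \<open>
  With black arguments the cost depends only on the tupler substituted for the head variable,
  so it is invariant under \<open>\<eta>\<close>; with white arguments it also counts the binders and the arguments
  of the head normal form, so it detects the direction of \<open>\<eta>\<close>.
\<close>

lemma ahead_hnf:
  fixes q :: "nat \<Rightarrow> nat" and f :: "nat \<Rightarrow> checkers"
  assumes t: "head_red\<^sup>*\<^sup>* t (hnf m y ts)" and "m \<le> M"
    and e: "e = q (y + (M - m))" and D: "e = D + (length ts + (M - m))" and "D < L"
  shows "ahead (if d = White then m + length ts else Suc e)
     (apps (tsubst (\<lambda>i. q (i + M)) (paint_black t)) (feed d M q @ map (\<lambda>j. (d, f j)) [0..<L] @ us))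
     (apps (f D) (map (Pair White) (map (\<lambda>s. tsubst (\<lambda>i. q (i + (M - m))) (paint_black s)) ts
          @ map (\<lambda>j. tupler (q (M - 1 - j))) [m..<M] @ map f [0..<D])
        @ map (\<lambda>j. (d, f j)) [Suc D..<L] @ us))"
proof -
  let ?q = "\<lambda>i. q (i + (M - m))"
  let ?X = "map (\<lambda>j. (d, tupler (q (M - 1 - j)))) [m..<M]"
  let ?F = "map (\<lambda>j. (d, f j)) [0..<L]"
  let ?B = "apps (Var y) (map (\<lambda>s. (Black, paint_black s)) ts)"
  let ?T = "map (\<lambda>s. (Black, tsubst ?q (paint_black s))) ts"
  let ?V = "?T @ ?X @ map (\<lambda>j. (d, f j)) [0..<D]"
  have 0: "ahead 0 (apps (tsubst (\<lambda>i. q (i + M)) (paint_black t)) (feed d M q @ ?F @ us))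
      (apps (tsubst (\<lambda>i. q (i + M)) ((Lam Black ^^ m) ?B)) (feed d m ?q @ ?X @ ?F @ us))"
    using ahead_head_red[OF t, of _ "feed d M q @ ?F @ us"] feed_split[OF \<open>m \<le> M\<close>, of d q]
    by (simp add: paint_black_hnf)
  have "ahead (if d = Black then 0 else m)
      (apps (tsubst (\<lambda>i. q (i + M)) ((Lam Black ^^ m) ?B)) (feed d m ?q @ ?X @ ?F @ us))
      (apps (tsubst ?q ?B) (?X @ ?F @ us))"
    by (rule ahead_feed) (use \<open>m \<le> M\<close> in simp_all)
  from ahead_trans[OF 0 this] have 1: "ahead (if d = Black then 0 else m)
      (apps (tsubst (\<lambda>i. q (i + M)) (paint_black t)) (feed d M q @ ?F @ us))
      (apps (tsubst ?q ?B) (?X @ ?F @ us))"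
    by (simp only: add_0)
  \<comment> \<open>The tupler at the head collects \<open>e\<close> arguments: those of the head
    normal form, the \<open>M - m\<close> surplus tuplers and the first \<open>D\<close> values of
    \<open>f\<close>. So \<open>f D\<close> comes to the head.\<close>
  have "[0..<L] = [0..<D] @ D # [Suc D..<L]"
    using upt_add_eq_append[of 0 D "L - D"] \<open>D < L\<close> by (simp add: upt_conv_Cons)
  then have 2: "apps (tsubst ?q ?B) (?X @ ?F @ us)
      = apps (tupler e) (?V @ (d, f D) # map (\<lambda>j. (d, f j)) [Suc D..<L] @ us)"
    by (simp add: psubst_apps e o_def)
  have "length ?V = e"
    using D by simp
  from ahead_tupler[OF this, of d "f D" "map (\<lambda>j. (d, f j)) [Suc D..<L] @ us"]
  \<comment> \<open>The arguments \<open>ts\<close> are applied in black and always cost one each;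
    the other \<open>e - length ts\<close> and \<open>f D\<close> cost only if \<open>d\<close> is
    black.\<close>
  have 3: "ahead (length ts + (if d = White then 0 else Suc (e - length ts)))
      (apps (tsubst ?q ?B) (?X @ ?F @ us))
      (apps (f D) (map (Pair White \<circ> snd) ?V @ map (\<lambda>j. (d, f j)) [Suc D..<L] @ us))"
    unfolding 2 by (rule back_subst[of "\<lambda>c. ahead c _ _"]) (use D in \<open>simp add: filter_map o_def\<close>)
  have 4: "map (Pair White \<circ> snd) ?V = map (Pair White) (map (\<lambda>s. tsubst ?q (paint_black s)) ts
          @ map (\<lambda>j. tupler (q (M - 1 - j))) [m..<M] @ map f [0..<D])"
    by simp
  have 5: "(if d = Black then 0 else m) + (length ts + (if d = White then 0 else Suc (e - length ts)))
      = (if d = White then m + length ts else Suc e)"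
    using D by (cases d) simp_all
  show ?thesis
    using ahead_trans[OF 1 3] unfolding 4 5 .
qed

lemma ahead_hnf_white:
  fixes q :: "nat \<Rightarrow> nat" and f :: "nat \<Rightarrow> checkers"
  assumes "head_red\<^sup>*\<^sup>* t (hnf m y ts)" "m \<le> M"
    and "e = q (y + (M - m))" "e = D + (length ts + (M - m))" "D < L"
  shows "\<exists>us. ahead (m + length ts)
     (apps (tsubst (\<lambda>i. q (i + M)) (paint_black t)) (feed White M q @ map (\<lambda>j. (White, f j)) [0..<L]))
     (apps (f D) us)"
  using ahead_hnf[of t m y ts M e q D L White f "[]", OF assms] unfolding append_Nil2 if_P[OF HOL.refl] by (rule exI)

section \<open>Extraction of subterms\<close>

text \<open>The bound \<open>K\<close> is existential because each extraction raises it by the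
  number of arguments, so no bound fixed in advance survives the coinduction.\<close>

definition tupled_imp :: "lterm \<Rightarrow> lterm \<Rightarrow> bool" where
  "tupled_imp t u \<longleftrightarrow> (\<exists>K. \<forall>q. (\<forall>i. K \<le> q i) \<longrightarrow>
     (\<forall>us k. apps (tsubst q (paint_black t)) us \<Down> k \<longrightarrow>
        (\<exists>k'\<le>k. apps (tsubst q (paint_black u)) us \<Down> k')))"

lemma plug_CAppLs:
  "plug (foldl (\<lambda>C (d, v). CAppL d C v) C us) t = apps (plug C t) us"
  by (induction us arbitrary: C) auto

lemma plug_CLams: "plug ((CLam c ^^ n) C) t = (Lam c ^^ n) (plug C t)"
  by (induction n) simp_all

text \<open>White abstractions over the free variables of both terms, applied in white to tuplers,
  perform the substitution at no cost.\<close>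

lemma int_imp_imp_tupled_imp:
  assumes "int_imp t u"
  shows "tupled_imp t u"
proof -
  obtain M N where
      M: "\<And>\<sigma> \<tau>. (\<forall>i<M. \<sigma> i = \<tau> i) \<Longrightarrow> psubst \<sigma> (paint_black t) = psubst \<tau> (paint_black t)" and
      N: "\<And>\<sigma> \<tau>. (\<forall>i<N. \<sigma> i = \<tau> i) \<Longrightarrow> psubst \<sigma> (paint_black u) = psubst \<tau> (paint_black u)"
    using psubst_finite_support[of "paint_black t"] psubst_finite_support[of "paint_black u"] by blast
  define n where "n = max M N"
  have "\<exists>k'\<le>k. apps (tsubst q (paint_black u)) us \<Down> k'"
    if k: "apps (tsubst q (paint_black t)) us \<Down> k" for q us k
  proof -
    let ?\<sigma> = "\<lambda>i. if i < n then tupler (q i) else Var (i - n)"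
    let ?C = "foldl (\<lambda>C (d, v). CAppL d C v) ((CLam White ^^ n) Hole) (feed White n q @ us)"
    have *: "ahead 0 (plug ?C s) (apps (psubst ?\<sigma> s) us)" for s
      using ahead_feed[of n ?\<sigma> q Var White White s us]
      by (simp add: plug_CAppLs plug_CLams)
    have "psubst ?\<sigma> (paint_black t) = tsubst q (paint_black t)"
        "psubst ?\<sigma> (paint_black u) = tsubst q (paint_black u)"
      by (rule M N; auto simp: n_def)+
    with *[of "paint_black t"] *[of "paint_black u"]
    have t': "ahead 0 (plug ?C (paint_black t)) (apps (tsubst q (paint_black t)) us)"
      and u': "ahead 0 (plug ?C (paint_black u)) (apps (tsubst q (paint_black u)) us)"
      by simp_all
    show ?thesis
      by (rule ahead_transfer[OF t' u' _ k]) (use assms in \<open>unfold int_imp_def, blast\<close>)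
  qed
  then show ?thesis by (auto simp: tupled_imp_def)
qed

lemma tupled_imp_has_hnf:
  assumes "tupled_imp t u" "head_red\<^sup>*\<^sup>* t (hnf m y ts)"
  shows "has_hnf u"
proof -
  from assms(1) obtain K where
      K: "\<And>q us k. (\<And>i. K \<le> q i) \<Longrightarrow> apps (tsubst q (paint_black t)) us \<Down> k
        \<Longrightarrow> \<exists>k'\<le>k. apps (tsubst q (paint_black u)) us \<Down> k'"
    unfolding tupled_imp_def by blast
  \<comment> \<open>One arity for all variables: after the \<open>length ts\<close> arguments the
    tupler absorbs \<open>K\<close> copies of \<open>Var 0\<close>, and the last copy becomes the
    head.\<close>
  let ?e = "K + length ts"
  let ?us = "feed White m (\<lambda>_. ?e) @ map (\<lambda>_. (White, Var 0)) [0..<Suc K]"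
  have "?e = K + (length ts + (m - m))" by simp
  from ahead_hnf_white[OF assms(2) order_refl HOL.refl this lessI, of "\<lambda>_. Var 0"]
  obtain vs where
    "ahead (m + length ts) (apps (tsubst (\<lambda>_. ?e) (paint_black t)) ?us) (apps (Var 0) vs)" ..
  then have "apps (tsubst (\<lambda>_. ?e) (paint_black t)) ?us \<Down> (m + length ts)"
    by (rule ahead_apps_Var)
  from K[OF _ this] obtain k' where "apps (tsubst (\<lambda>_. ?e) (paint_black u)) ?us \<Down> k'"
    by (meson le_add1)
  then show ?thesis by (rule converges_imp_has_hnf)
qed

text \<open>
  The argument that ends up in head position is the one at position \<open>q y - A\<close> after the initial
  ones; making it a variable and all others divergent turns any discrepancy into divergence of \<open>u\<close>.
\<close>

lemma tupled_imp_same_shape: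
  assumes "tupled_imp t u"
    and t: "head_red\<^sup>*\<^sup>* t (hnf m y ts)" and u: "head_red\<^sup>*\<^sup>* u (hnf n z us)"
  shows "n \<le> m" and "y = z + (m - n)" and "length ts = length us + (m - n)"
proof -
  from assms(1) obtain K where
      K: "\<And>q us k. (\<And>i. K \<le> q i) \<Longrightarrow> apps (tsubst q (paint_black t)) us \<Down> k
        \<Longrightarrow> \<exists>k'\<le>k. apps (tsubst q (paint_black u)) us \<Down> k'"
    unfolding tupled_imp_def by blast
  \<comment> \<open>Both sides are viewed as \<open>\<eta>\<close>-expanded to \<open>M\<close>
    binders: \<open>A\<close> and \<open>B\<close> are then the numbers of arguments,
    \<open>Y\<close> and \<open>Z\<close> the indices of the head variables.\<close>
  define M where "M = max m n"
  define A where "A = length ts + (M - m)"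
  define B where "B = length us + (M - n)"
  define Y where "Y = y + (M - m)"
  define Z where "Z = z + (M - n)"
  \<comment> \<open>Large enough that the subtractions \<open>q Y - A\<close> and
    \<open>q Z - B\<close> below are not truncated.\<close>
  define E where "E = K + A + B"
  have *: "q Y - A = q Z - B \<and> n + length us \<le> m + length ts" if q: "\<And>i. E \<le> q i" for q
  proof -
    let ?D = "q Y - A" and ?D' = "q Z - B"
    let ?f = "\<lambda>j. if j = ?D then Var 0 else Omega"
    let ?L = "Suc (?D + ?D')"
    let ?us = "feed White M q @ map (\<lambda>j. (White, ?f j)) [0..<?L]"
    let ?q = "\<lambda>i. q (i + M)"
    have "q Y = ?D + (length ts + (M - m))" "q Z = ?D' + (length us + (M - n))"
      using q[of Y] q[of Z] by (simp_all add: E_def A_def B_def)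
    moreover have "m \<le> M" "n \<le> M" "?D < ?L" "?D' < ?L"
      by (simp_all add: M_def)
    ultimately have
      ex: "\<exists>vs. ahead (m + length ts) (apps (tsubst ?q (paint_black t)) ?us) (apps (?f ?D) vs)"
        "\<exists>vs. ahead (n + length us) (apps (tsubst ?q (paint_black u)) ?us) (apps (?f ?D') vs)"
      using ahead_hnf_white[OF t, of M "q Y" q ?D ?L ?f] ahead_hnf_white[OF u, of M "q Z" q ?D' ?L ?f]
      unfolding Y_def Z_def by blast+
    have "?f ?D = Var 0" by simp
    with ex(1) obtain vs where
      "ahead (m + length ts) (apps (tsubst ?q (paint_black t)) ?us) (apps (Var 0) vs)"
      by (elim exE) (simp only:)
    then have t': "apps (tsubst ?q (paint_black t)) ?us \<Down> (m + length ts)"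
      by (rule ahead_apps_Var)
    have "K \<le> ?q i" for i
      using q[of "i + M"] by (simp add: E_def)
    from K[OF this t'] obtain k' where
      k': "k' \<le> m + length ts" "apps (tsubst ?q (paint_black u)) ?us \<Down> k'" by blast
    from ex(2) obtain vs' where
      "ahead (n + length us) (apps (tsubst ?q (paint_black u)) ?us) (apps (?f ?D') vs')" ..
    with k'(2) obtain k where k: "k' = k + (n + length us)" "apps (?f ?D') vs' \<Down> k"
      unfolding ahead_def by meson
    from k(2) have "?D' = ?D"
      by (metis Omega_diverges)
    with k(1) k'(1) show ?thesis by simp
  qed
  have "A = B"
    using *[of "\<lambda>_. E"] by (simp add: E_def)
  moreover have "n + length us \<le> m + length ts"
    using *[of "\<lambda>_. E"] by simp
  \<comment> \<open>\<open>A = B\<close> equates the differences between arguments and binders, so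
    the inequality between their sums gives \<open>n \<le> m\<close>.\<close>
  ultimately show "n \<le> m" "length ts = length us + (m - n)"
    by (auto simp: A_def B_def M_def max_def split: if_splits)
  have "Y = Z"
  proof (rule ccontr)
    assume "Y \<noteq> Z"
    \<comment> \<open>A larger arity at \<open>Y\<close> alone moves the position for
      \<open>t\<close> by one and leaves that for \<open>u\<close>, against
      \<open>A = B\<close>.\<close>
    moreover have "E \<le> ((\<lambda>_. E)(Y := Suc E)) i" for i by simp
    note *[of "(\<lambda>_. E)(Y := Suc E)", OF this]
    ultimately show False using \<open>A = B\<close> by (simp add: E_def)
  qed
  then show "y = z + (m - n)"
    using \<open>n \<le> m\<close> by (simp add: Y_def Z_def M_def)
qed

text \<open>Black feeding costs \<open>Suc e\<close> on both sides, so this cost cancels once a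
  selector at the head has returned the \<open>i\<close>-th component. Past the arguments
  \<open>us\<close>, the component for \<open>u\<close> is a surplus tupler, the image of one of the
  extra binders of \<open>t\<close>.\<close>

lemma tupled_imp_extract:
  assumes "tupled_imp t u"
    and t: "head_red\<^sup>*\<^sup>* t (hnf (n + p) (z + p) ts)" and u: "head_red\<^sup>*\<^sup>* u (hnf n z us)"
    and len: "length ts = length us + p"
    and i: "i < length ts"
  shows "tupled_imp (ts ! i)
    (if i < length us then lift p 0 (us ! i) else Var (p - 1 - (i - length us)))"
    (is "tupled_imp _ ?u")
proof -
  from assms(1) obtain K where
      K: "\<And>q us k. (\<And>i. K \<le> q i) \<Longrightarrow> apps (tsubst q (paint_black t)) us \<Down> k
        \<Longrightarrow> \<exists>k'\<le>k. apps (tsubst q (paint_black u)) us \<Down> k'"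
    unfolding tupled_imp_def by blast
  have "\<exists>k'\<le>k. apps (tsubst q (paint_black ?u)) vs \<Down> k'"
    if q: "\<And>i. K + length ts \<le> q i" and k: "apps (tsubst q (paint_black (ts ! i))) vs \<Down> k"
    for q vs k
  proof -
    define e where "e = q (z + p)"
    \<comment> \<open>The same position serves both sides: \<open>u\<close> has \<open>p\<close>
      fewer arguments but leaves \<open>p\<close> fed tuplers over.\<close>
    define D where "D = e - length ts"
    have e: "e = D + length ts"
      using q[of "z + p"] by (simp add: D_def e_def)
    let ?M = "n + p"
    \<comment> \<open>Only \<open>?f D\<close> reaches the head; the copies of \<open>Var 0\<close>
      are padding that the selector discards.\<close>
    let ?f = "\<lambda>j. if j < D then Var 0 else selector i e"
    let ?us = "feed Black ?M q @ map (\<lambda>j. (Black, ?f j)) [0..<Suc D] @ vs"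
    let ?q = "\<lambda>i. q (i + ?M)"
    let ?X = "map (\<lambda>j. tupler (q (?M - 1 - j))) [n..<?M]"
    let ?W = "map (\<lambda>s. tsubst q (paint_black s)) ts @ map ?f [0..<D]"
    let ?W' = "map (\<lambda>s. tsubst (\<lambda>i. q (i + p)) (paint_black s)) us @ ?X @ map ?f [0..<D]"
    have t1: "ahead (Suc e) (apps (tsubst ?q (paint_black t)) ?us)
        (apps (selector i e) (map (Pair White) ?W @ vs))"
      using ahead_hnf[OF t order_refl, of e q D "Suc D" Black ?f vs] e
      by (simp add: e_def del: apps_simps)
    have t2: "ahead 0 (apps (selector i e) (map (Pair White) ?W @ vs)) (apps (?W ! i) vs)"
      by (rule ahead_selector) (use e i in simp_all)
    have t3: "?W ! i = tsubst q (paint_black (ts ! i))"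
      using i by (simp add: nth_append)
    have 1: "ahead (Suc e) (apps (tsubst ?q (paint_black t)) ?us)
        (apps (tsubst q (paint_black (ts ! i))) vs)"
      using ahead_trans[OF t1 t2] unfolding t3 add_0_right .
    have u1: "ahead (Suc e) (apps (tsubst ?q (paint_black u)) ?us)
        (apps (selector i e) (map (Pair White) ?W' @ vs))"
      using ahead_hnf[OF u le_add1, of e q p D "Suc D" Black ?f vs] e len
      by (simp add: e_def del: apps_simps)
    have u2: "ahead 0 (apps (selector i e) (map (Pair White) ?W' @ vs)) (apps (?W' ! i) vs)"
      by (rule ahead_selector) (use e i len in simp_all)
    \<comment> \<open>For an argument of \<open>u\<close>, the shift of \<open>q\<close> by
      \<open>p\<close> is the weakening by \<open>p\<close>; for a surplus tupler, the index is that
      of the extra binder.\<close>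
    have u3: "?W' ! i = tsubst q (paint_black ?u)"
      using i len
      by (auto simp: nth_append paint_black_def map_trm_lift psubst_lift
          intro!: arg_cong[of _ _ tupler] arg_cong[of _ _ q])
    have 2: "ahead (Suc e) (apps (tsubst ?q (paint_black u)) ?us)
        (apps (tsubst q (paint_black ?u)) vs)"
      using ahead_trans[OF u1 u2] unfolding u3 add_0_right .
    show ?thesis
      by (rule ahead_transfer[OF 1 2 K k]) (use q add_leE in blast)+
  qed
  then show ?thesis
    unfolding tupled_imp_def by blast
qed

section \<open>The coinduction\<close>

theorem theorem3:
  fixes t u :: lterm
  assumes "int_imp t u"
  shows "bohm_eta_red t u"
proof -
  from assms have "tupled_imp t u" by (rule int_imp_imp_tupled_imp)
  then show ?thesis
  proof (coinduction arbitrary: t u)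
    case bohm_eta_red
    show ?case
    proof (cases "has_hnf t")
      case True
      then obtain m y ts where t: "head_red\<^sup>*\<^sup>* t (hnf m y ts)" by (rule has_hnfE)
      obtain n z us where u: "head_red\<^sup>*\<^sup>* u (hnf n z us)"
        using tupled_imp_has_hnf[OF bohm_eta_red t] by (rule has_hnfE)
      define p where "p = m - n"
      note shape = tupled_imp_same_shape[OF bohm_eta_red t u]
      have m: "m = n + p" and y: "y = z + p" and len: "length ts = length us + p"
        using shape by (simp_all add: p_def)
      note components = tupled_imp_extract[OF bohm_eta_red t[unfolded m y] u len]
      have "tupled_imp (ts ! i) (lift p 0 (us ! i))" if "i < length us" for i
        using components[of i] that len by simp
      moreover have "tupled_imp (ts ! (length us + j)) (Var (p - 1 - j))" if "j < p" for j
        using components[of "length us + j"] that len by simp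
      ultimately show ?thesis
        using t[unfolded m y] u len by blast
    qed blast
  qed
qed

end
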